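(* Let $G$ be a connected bipartite graph on the vertex set $V=\{1,\dots,n\}$, $n\ge 2$, with bipartition $(A,B)$, let $R=k[x_1,\dots,x_n]$ be a polynomial ring over a field $k$, and let $I=I(G)\subset R$ be the edge ideal of $G$. Then $$\operatorname{dstab}(I)=\min\{|\mathbf a|/2\ :\ \mathbf a\in\mathbb N^n\text{ is a solution of }( * )\}+1,$$ where $( * )$ is the system $$( * )\qquad \sum_{i\in A}a_i=\sum_{i\in B}a_i,\qquad \sum_{i\in C}a_i>\sum_{i\in A}a_i\ \text{ for all } C\in\operatorname{Min}(G),\ C\ne A,B.$$
   Context: All graphs are finite and simple; $\mathbb N$ includes $0$. The edge ideal $I(G)$ is generated by the monomials $x_ix_j$ with $\{i,j\}$ an edge of $G$. $\operatorname{Min}(G)$ is the set of (inclusion-)minimal vertex covers of $G$. $|\mathbf a|=a_1+\cdots+a_n$. For a homogeneous ideal $I$, $\operatorname{dstab}(I)$ is the smallest integer $s\ge 1$ such that $\operatorname{depth} R/I^t=\operatorname{depth} R/I^s$ for all $t\ge s$. *)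

theory Defs
  imports
    Complex_Main
    "HOL-Library.Poly_Mapping"
    "HOL-Library.Extended_Nat"
    "Graph_Theory.Digraph_Component"
begin

text \<open>
  For a finite type \<open>'v\<close>, the polynomial ring \<open>k[x\<^sub>v | v]\<close> is the type of finitely supported
  maps from exponent vectors to \<open>'k\<close>; its multiplication is convolution.
\<close>

type_synonym ('v, 'k) mpoly = "('v \<Rightarrow>\<^sub>0 nat) \<Rightarrow>\<^sub>0 'k"

definition var :: "'v \<Rightarrow> ('v, 'k::field) mpoly" where
  "var v = Poly_Mapping.single (Poly_Mapping.single v 1) 1"

text \<open>A commutative ring is a module over itself, and its submodules are its ideals.\<close>

abbreviation ideal_gen :: "'a::comm_ring_1 set \<Rightarrow> 'a set" where
  "ideal_gen S \<equiv> module.span (*) S"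

lemma module_self: "module ((*) :: 'a::comm_ring_1 \<Rightarrow> 'a \<Rightarrow> 'a)"
  by unfold_locales (simp_all add: algebra_simps)

definition ideal_mult :: "'a::comm_ring_1 set \<Rightarrow> 'a set \<Rightarrow> 'a set" where
  "ideal_mult I J = ideal_gen {a * b | a b. a \<in> I \<and> b \<in> J}"

primrec ideal_power :: "'a::comm_ring_1 set \<Rightarrow> nat \<Rightarrow> 'a set" where
  "ideal_power I 0 = UNIV"
| "ideal_power I (Suc t) = ideal_mult I (ideal_power I t)"

text \<open>
  \<open>fs\<close> is a regular sequence on the module \<open>M = R/J\<close>. The module \<open>M/(f\<^sub>1,\<dots>,f\<^sub>i)M\<close> is the
  quotient of \<open>R\<close> by \<open>J + (f\<^sub>1,\<dots>,f\<^sub>i)\<close>, so that the next element being a nonzerodivisor on it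
  and \<open>M \<noteq> (f\<^sub>1,\<dots>,f\<^sub>r)M\<close> become statements about membership in these ideals.
\<close>

definition regular_seq_on_quotient :: "'a::comm_ring_1 set \<Rightarrow> 'a list \<Rightarrow> bool" where
  "regular_seq_on_quotient J fs \<longleftrightarrow>
     (\<forall>i<length fs. \<forall>g.
        fs ! i * g \<in> ideal_gen (J \<union> set (take i fs)) \<longrightarrow>
        g \<in> ideal_gen (J \<union> set (take i fs))) \<and>
     ideal_gen (J \<union> set fs) \<noteq> UNIV"

definition irrelevant_ideal :: "('v, 'k::field) mpoly set" where
  "irrelevant_ideal = ideal_gen (range var)"

text \<open>
  The depth of \<open>R/J\<close>: the supremum of the lengths of regular sequences on \<open>R/J\<close> in the ideal
  generated by the variables. It is only used for proper ideals \<open>J\<close>; the value for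
  \<open>J = R\<close> is 0 here.
\<close>

definition depth_quotient :: "('v, 'k::field) mpoly set \<Rightarrow> enat" where
  "depth_quotient J =
     Sup {enat (length fs) | fs. set fs \<subseteq> irrelevant_ideal \<and> regular_seq_on_quotient J fs}"

definition depth_stable_from :: "('v, 'k::field) mpoly set \<Rightarrow> nat \<Rightarrow> bool" where
  "depth_stable_from I s \<longleftrightarrow>
     s \<ge> 1 \<and> (\<forall>t\<ge>s. depth_quotient (ideal_power I t) = depth_quotient (ideal_power I s))"

definition dstab :: "('v, 'k::field) mpoly set \<Rightarrow> nat" where
  "dstab I = (LEAST s. depth_stable_from I s)"

text \<open>
  Finite simple graphs are given by \<^locale>\<open>pair_graph\<close>: an edge \<open>{u, v}\<close> is represented by the
  two arcs \<open>(u, v)\<close> and \<open>(v, u)\<close>.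
\<close>

definition edge_ideal :: "'v pair_pre_digraph \<Rightarrow> ('v, 'k::field) mpoly set" where
  "edge_ideal G = ideal_gen {var u * var v | u v. (u, v) \<in> parcs G}"

definition bipartition :: "'v pair_pre_digraph \<Rightarrow> 'v set \<Rightarrow> 'v set \<Rightarrow> bool" where
  "bipartition G A B \<longleftrightarrow>
     A \<union> B = pverts G \<and> A \<inter> B = {} \<and>
     (\<forall>(u, v)\<in>parcs G. (u \<in> A \<and> v \<in> B) \<or> (u \<in> B \<and> v \<in> A))"

definition vertex_cover :: "'v pair_pre_digraph \<Rightarrow> 'v set \<Rightarrow> bool" where
  "vertex_cover G C \<longleftrightarrow> C \<subseteq> pverts G \<and> (\<forall>(u, v)\<in>parcs G. u \<in> C \<or> v \<in> C)"

definition min_vertex_covers :: "'v pair_pre_digraph \<Rightarrow> 'v set set" where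
  "min_vertex_covers G = {C. vertex_cover G C \<and> (\<forall>D. vertex_cover G D \<longrightarrow> \<not> D \<subset> C)}"

definition cover_system_solution ::
  "'v pair_pre_digraph \<Rightarrow> 'v set \<Rightarrow> 'v set \<Rightarrow> ('v \<Rightarrow> nat) \<Rightarrow> bool" where
  "cover_system_solution G A B a \<longleftrightarrow>
     (\<Sum>i\<in>A. a i) = (\<Sum>i\<in>B. a i) \<and>
     (\<forall>C\<in>min_vertex_covers G. C \<noteq> A \<and> C \<noteq> B \<longrightarrow> (\<Sum>i\<in>C. a i) > (\<Sum>i\<in>A. a i))"

end

theory Submission
  imports Defs
begin

text \<open>
  By a weighted form of Koenig's theorem, \<open>x\<^sup>a\<close> lies in \<open>I\<^sup>t\<close> iff \<open>a(C) \<ge> t\<close> for every minimal vertex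
  cover \<open>C\<close>; that is, \<open>J = I\<^sup>t\<close> is the intersection of the powers \<open>P\<^sub>C\<^sup>t\<close> of the monomial primes
  \<open>P\<^sub>C\<close>. No \<open>C\<close> contains all vertices, so \<open>f = \<Sum> x\<^sub>l\<close> is a nonzerodivisor on \<open>R/J\<close> and the
  depth is at least 1.

  A solution \<open>a\<close> with \<open>a(A) = a(B) = t - 1\<close> satisfies \<open>J : x\<^sup>a = P\<^sub>A \<inter> P\<^sub>B\<close>. The two components
  meet only in the origin, and this excludes a regular sequence of length 2. Adding an
  edge to \<open>a\<close> gives a solution for \<open>t + 1\<close>, so the depth stays 1.

  If there is no such solution, then for every \<open>a\<close> the covers \<open>C\<close> with \<open>a(C) < t\<close> are connected
  under the relation \<open>C \<union> D \<noteq> V\<close>. With pairwise distinct exponents \<open>e\<^sub>l > 0\<close>, the forms \<open>f\<close> and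
  \<open>g = \<Sum> x\<^sub>l\<^sup>e\<close> (with \<open>e = e\<^sub>l\<close>) are a regular sequence modulo each \<open>P\<^sub>C\<^sup>t\<close>, and connectedness glues
  the local quotients by \<open>f\<close> to a quotient modulo \<open>J\<close>. Hence \<open>f, g\<close> is regular on \<open>R/J\<close> and the
  depth is at least 2.
\<close>

section \<open>Monomial ideals\<close>

interpretation ideal: module "(*) :: 'a::comm_ring_1 \<Rightarrow> 'a \<Rightarrow> 'a"
  by (rule module_self)

text \<open>As a simplification rule this associates products to the left, against \<open>algebra_simps\<close>.\<close>

declare ideal.scale_scale [simp del]

abbreviation "lookup \<equiv> Poly_Mapping.lookup"
abbreviation "keys \<equiv> Poly_Mapping.keys"
abbreviation "single \<equiv> Poly_Mapping.single"

text \<open>For upward closed \<open>Q\<close> this is the monomial ideal spanned by the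
  \<open>x^a\<close> with \<open>Q a\<close>; for other \<open>Q\<close> it is only a linear
  subspace, used to bound the degree in a variable.\<close>

definition supported :: "(('v \<Rightarrow>\<^sub>0 nat) \<Rightarrow> bool) \<Rightarrow> ('v, 'k::field) mpoly set" where
  "supported Q = {p. \<forall>a. lookup p a \<noteq> 0 \<longrightarrow> Q a}"

definition upclosed :: "(('v \<Rightarrow>\<^sub>0 nat) \<Rightarrow> bool) \<Rightarrow> bool" where
  "upclosed Q \<longleftrightarrow> (\<forall>a b. Q a \<longrightarrow> Q (a + b))"

lemma upclosedD: "upclosed Q \<Longrightarrow> Q a \<Longrightarrow> Q (b + a)"
  by (metis add.commute upclosed_def)

lemma supported_zero [simp]: "0 \<in> supported Q"
  by (simp add: supported_def)

lemma supported_add: "p \<in> supported Q \<Longrightarrow> q \<in> supported Q \<Longrightarrow> p + q \<in> supported Q"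
  unfolding supported_def by (auto simp: lookup_add) (metis add_0)

lemma supported_uminus: "p \<in> supported Q \<Longrightarrow> - p \<in> supported Q"
  by (simp add: supported_def)

lemma supported_diff: "p \<in> supported Q \<Longrightarrow> q \<in> supported Q \<Longrightarrow> p - q \<in> supported Q"
  using supported_add[of p Q "- q"] supported_uminus[of q Q] by simp

lemma supported_sum: "(\<And>x. x \<in> X \<Longrightarrow> p x \<in> supported Q) \<Longrightarrow> sum p X \<in> supported Q"
  by (induction X rule: infinite_finite_induct) (auto intro: supported_add)

lemma supported_mono: "p \<in> supported P \<Longrightarrow> (\<And>a. P a \<Longrightarrow> Q a) \<Longrightarrow> p \<in> supported Q"
  by (auto simp: supported_def)

lemma supported_single: "Q a \<Longrightarrow> single a c \<in> supported Q"
  by (auto simp: supported_def lookup_single when_def)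

lemma supported_mult:
  assumes "p \<in> supported P" "q \<in> supported Q" "\<And>a b. P a \<Longrightarrow> Q b \<Longrightarrow> S (a + b)"
  shows "p * q \<in> supported S"
proof -
  have "S c" if c: "c \<in> keys (p * q)" for c
  proof -
    obtain a b where "c = a + b" "a \<in> keys p" "b \<in> keys q"
      using keys_mult[of p q] c by blast
    then show ?thesis
      using assms by (auto simp: supported_def in_keys_iff)
  qed
  then show ?thesis
    by (simp add: supported_def in_keys_iff)
qed

lemma supported_power:
  assumes "p \<in> supported Q" "Q 0" "\<And>a b. Q a \<Longrightarrow> Q b \<Longrightarrow> Q (a + b)"
  shows "p ^ n \<in> supported Q"
proof (induction n)
  case (Suc n)
  then show ?case
    unfolding power_Suc using assms by (blast intro: supported_mult)
qed (use assms(2) in \<open>simp add: supported_def lookup_one when_def\<close>)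

lemma supported_mult_right: "upclosed Q \<Longrightarrow> q \<in> supported Q \<Longrightarrow> p * q \<in> supported Q"
  by (rule supported_mult[of _ "\<lambda>_. True" _ Q])
    (auto simp: supported_def upclosedD)

lemma subspace_supported: "upclosed Q \<Longrightarrow> ideal.subspace (supported Q)"
  unfolding ideal.subspace_def by (auto intro: supported_add supported_mult_right)

lemma lookup_single_mult:
  fixes m :: "'v \<Rightarrow>\<^sub>0 nat"
  shows "lookup (single m c * p) (m + b) = c * lookup p b"
  by (simp add: lookup_mult lookup_single when_mult)

text \<open>The coefficient of \<open>h r\<close> is compared with that of \<open>x\<^sub>j\<^sup>e r\<close> at \<open>x\<^sub>j\<^sup>e x\<^sup>a\<close>, where \<open>x\<^sup>a\<close>
  has maximal degree in \<open>x\<^sub>j\<close> among the monomials of \<open>r\<close> that violate \<open>Q\<close>.\<close>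

lemma monic_cancel:
  fixes h r :: "('v, 'k::field) mpoly"
  assumes up: "upclosed Q" and down: "\<And>a. Q (a + single j e) \<Longrightarrow> Q a"
    and h: "h \<in> supported (\<lambda>a. lookup a j < e)"
    and fr: "(single (single j e) 1 + h) * r
      \<in> supported (\<lambda>b. Q b \<or> lookup b j < e)"
  shows "r \<in> supported Q"
proof (rule ccontr)
  define S where "S = {a \<in> keys r. \<not> Q a}"
  assume "r \<notin> supported Q"
  then have "S \<noteq> {}"
    by (auto simp: S_def supported_def in_keys_iff)
  moreover have "finite S"
    by (simp add: S_def)
  ultimately have "Max ((\<lambda>a. lookup a j) ` S) \<in> (\<lambda>a. lookup a j) ` S"
    by (intro Max_in) auto
  then obtain a where a: "a \<in> S" "Max ((\<lambda>a. lookup a j) ` S) = lookup a j"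
    by auto
  have max: "lookup k j \<le> lookup a j" if "k \<in> S" for k
    using Max_ge[of "(\<lambda>a. lookup a j) ` S" "lookup k j"] that \<open>finite S\<close> a(2) by simp
  define b where "b = single j e + a"
  have nQ: "\<not> Q b"
    using down[of a] a(1) by (auto simp: b_def S_def add.commute)
  \<comment> \<open>In a contribution to \<open>b\<close> the exponent from \<open>r\<close>
    violates \<open>Q\<close> too, so its degree in \<open>x_j\<close> is at most that of
    \<open>a\<close>, while the exponent from \<open>h\<close> has degree below
    \<open>e\<close>.\<close>
  have "lookup (h * r) b = 0"
  proof (rule ccontr)
    assume "lookup (h * r) b \<noteq> 0"
    then obtain k1 k2 where k: "b = k1 + k2" "k1 \<in> keys h" "k2 \<in> keys r"
      using keys_mult[of h r] by (auto simp: in_keys_iff)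
    then have "k2 \<in> S"
      using nQ up by (auto simp: S_def upclosed_def add.commute)
    moreover have "lookup k1 j < e"
      using h k(2) by (auto simp: supported_def in_keys_iff)
    moreover have "lookup k1 j + lookup k2 j = e + lookup a j"
      using arg_cong[OF k(1), of "\<lambda>b. lookup b j"] by (simp add: b_def lookup_add)
    ultimately show False
      using max[of k2] by linarith
  qed
  then have "lookup ((single (single j e) 1 + h) * r) b = lookup r a"
    by (simp add: distrib_right lookup_add b_def lookup_single_mult)
  also have "\<dots> \<noteq> 0"
    using a(1) by (auto simp: S_def in_keys_iff)
  finally show False
    using fr nQ by (auto simp: supported_def b_def lookup_add)
qed

section \<open>Division by a linear form\<close>

definition linear_form :: "('v::finite, 'k::field) mpoly" where
  "linear_form = (\<Sum>l\<in>UNIV. var l)"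

lemma linear_form_split: "linear_form = var j + (\<Sum>l\<in>-{j}. var l)"
  unfolding linear_form_def by (metis Compl_eq_Diff_UNIV finite UNIV_I sum.remove)

lemma sum_var_free: "(\<Sum>l\<in>-{j}. var l) \<in> supported (\<lambda>a. lookup a j = 0)"
  by (intro supported_sum) (auto simp: var_def lookup_single intro!: supported_single)

text \<open>\<open>linear_form\<close> is monic of degree 1 in every variable. The slack
  \<open>lookup b j = 0\<close> lets a remainder free of \<open>x_j\<close> be ignored.\<close>

lemma linear_form_cancel:
  fixes r :: "('v::finite, 'k::field) mpoly"
  assumes "upclosed Q" "\<And>a. Q (a + single j 1) \<Longrightarrow> Q a"
    and "linear_form * r \<in> supported (\<lambda>b. Q b \<or> lookup b j = 0)"
  shows "r \<in> supported Q"
proof (rule monic_cancel)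
  show "(single (single j 1) 1 + (\<Sum>l\<in>-{j}. var l)) * r \<in> supported (\<lambda>b. Q b \<or> lookup b j < 1)"
    using assms(3) unfolding linear_form_split[of j] var_def[of j] by simp
qed (use assms sum_var_free[of j] in auto)

lemma single_power:
  "single (single l (1::nat)) (1::'k::field) ^ n
    = single (single l n) 1"
  by (induction n) (auto simp: mult_single single_add[symmetric])

lemma var_power: "var l ^ n = single (single l n) 1"
  by (simp only: var_def single_power)

text \<open>Modulo \<open>linear_form\<close>, \<open>x_i\<close> is minus the sum of the other
  variables and can be eliminated monomial by monomial.\<close>

lemma division_by_linear_form:
  fixes u :: "('v::finite, 'k::field) mpoly"
  shows "\<exists>w r. u = linear_form * w + r \<and> r \<in> supported (\<lambda>a. lookup a i = 0)"
proof -
  let ?F = "supported (\<lambda>a. lookup a i = 0) :: ('v, 'k) mpoly set"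
  let ?R = "\<Sum>l\<in>-{i}. var l :: ('v, 'k) mpoly"
  have mult: "p * q \<in> ?F" if "p \<in> ?F" "q \<in> ?F" for p q
    using that by (rule supported_mult) (simp add: lookup_add)
  have pow: "p ^ n \<in> ?F" if "p \<in> ?F" for p n
    using that by (rule supported_power) (simp_all add: lookup_add)
  have mono: "\<exists>w r. single a c = linear_form * w + r \<and> r \<in> ?F" for a c
  proof -
    define n where "n = lookup a i"
    define a' where "a' = a - single i n"
    have a: "a = single i n + a'"
      by (rule poly_mapping_eqI) (simp add: a'_def n_def lookup_add lookup_minus lookup_single when_def)
    have a'0: "lookup a' i = 0"
      by (simp add: a'_def n_def lookup_minus)
    have "var i - (- ?R) dvd var i ^ n - (- ?R) ^ n"
      by (simp add: power_diff_sumr2)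
    then obtain q where q: "var i ^ n = linear_form * q + (- ?R) ^ n"
      unfolding linear_form_split[of i] by (auto simp: dvd_def algebra_simps)
    have "single a c = var i ^ n * single a' c"
      unfolding var_power mult_single a by simp
    also have "\<dots> = linear_form * (q * single a' c) + (- ?R) ^ n * single a' c"
      unfolding q by (simp only: distrib_right mult.assoc)
    finally show ?thesis
      using mult[OF pow[OF supported_uminus[OF sum_var_free]] supported_single] a'0 by blast
  qed
  show ?thesis
  proof (induction u rule: update_induct)
    case const
    show ?case by (auto intro!: exI[of _ 0])
  next
    case (update f a b)
    obtain w r w' r' where "f = linear_form * w + r" "r \<in> ?F"
      and "single a b = linear_form * w' + r'" "r' \<in> ?F"
      using update mono[of a b] by blast
    moreover have "Poly_Mapping.update a b f = f + single a b"
      using update(1) by (intro poly_mapping_eqI)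
        (auto simp: lookup_update lookup_add lookup_single in_keys_iff when_def)
    ultimately have "Poly_Mapping.update a b f = linear_form * (w + w') + (r + r')" "r + r' \<in> ?F"
      by (auto simp: algebra_simps intro: supported_add)
    then show ?case by blast
  qed
qed

section \<open>The second form modulo a single component\<close>

definition power_form :: "('v::finite \<Rightarrow> nat) \<Rightarrow> ('v, 'k::field) mpoly" where
  "power_form e = (\<Sum>l\<in>UNIV. var l ^ e l)"

text \<open>Regroups \<open>g u - f v\<close> once \<open>u\<close> and the second form are reduced
  modulo \<open>f\<close>; here \<open>g\<close> is the reduced form and \<open>g + f * q\<close>
  the original one.\<close>

lemma division_identity:
  fixes f g q r v w :: "'a::comm_ring_1"
  shows "(g + f * q) * (f * w + r) - f * v = g * r - f * (v - (g + f * q) * w - q * r)"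
  by (simp add: algebra_simps)

text \<open>Modulo \<open>f\<close>, the variable \<open>x\<^sub>i\<close> is minus the sum of the others. The remainder \<open>g'\<close> of \<open>g\<close> is then
  free of \<open>x\<^sub>i\<close> and, since \<open>e i < e j\<close>, monic in \<open>x\<^sub>j\<close>.\<close>

lemma power_form_regular:
  fixes u v :: "('v::finite, 'k::field) mpoly"
  assumes up: "upclosed Q" and Qi: "\<And>a n. Q (a + single i n) \<Longrightarrow> Q a"
    and Qj: "\<And>a n. Q (a + single j n) \<Longrightarrow> Q a"
    and e: "e i < e j"
    and gu: "power_form e * u - linear_form * v \<in> supported Q"
  shows "\<exists>w. u - linear_form * w \<in> supported Q"
proof -
  have ij: "i \<noteq> j"
    using e by auto
  let ?f = "linear_form :: ('v, 'k) mpoly"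
  let ?R = "\<Sum>l\<in>-{i}. var l :: ('v, 'k) mpoly"
  let ?h = "(- ?R) ^ e i + (\<Sum>l\<in>-{i, j}. var l ^ e l)"
  define g' where "g' = single (single j (e j)) 1 + ?h"
  have "var i - (- ?R) dvd var i ^ e i - (- ?R) ^ e i"
    by (simp add: power_diff_sumr2)
  then obtain q where q: "var i ^ e i = ?f * q + (- ?R) ^ e i"
    unfolding linear_form_split[of i] by (auto simp: dvd_def algebra_simps)
  have "(UNIV :: 'v set) = insert i (insert j (- {i, j}))"
    by auto
  then have "power_form e = (\<Sum>l\<in>insert i (insert j (- {i, j})). var l ^ e l :: ('v, 'k) mpoly)"
    by (simp add: power_form_def)
  also have "\<dots> = var i ^ e i + (var j ^ e j + (\<Sum>l\<in>-{i, j}. var l ^ e l))"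
    using ij by simp
  finally have g: "power_form e = g' + ?f * q"
    unfolding q by (simp add: g'_def var_power algebra_simps)
  have free: "(- ?R) ^ n \<in> supported (\<lambda>a. lookup a i = 0)" for n
    by (intro supported_power supported_uminus sum_var_free) (simp_all add: lookup_add)
  have deg: "(- ?R) ^ n \<in> supported (\<lambda>a. lookup a j \<le> n)" for n
  proof (induction n)
    case (Suc n)
    have "- ?R \<in> supported (\<lambda>a. lookup a j \<le> 1)"
      by (intro supported_uminus supported_sum)
        (auto simp: var_def lookup_single when_def intro!: supported_single)
    then show ?case
      unfolding power_Suc using Suc by (rule supported_mult) (simp add: lookup_add)
  qed (simp add: supported_def lookup_one when_def)
  have h: "?h \<in> supported (\<lambda>a. lookup a j < e j)"
    using e by (intro supported_add supported_mono[OF deg] supported_sum)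
      (auto simp: var_power lookup_single when_def intro!: supported_single)
  have g'i: "g' \<in> supported (\<lambda>a. lookup a i = 0)"
    unfolding g'_def using ij by (intro supported_add free supported_sum)
      (auto simp: var_power lookup_single when_def intro!: supported_single)
  obtain w r where u: "u = ?f * w + r" and r: "r \<in> supported (\<lambda>a. lookup a i = 0)"
    using division_by_linear_form by blast
  define V where "V = v - power_form e * w - q * r"
  have gr: "g' * r - ?f * V \<in> supported Q"
    using gu unfolding V_def u g division_identity .
  have "g' * r \<in> supported (\<lambda>a. lookup a i = 0)"
    by (rule supported_mult[OF g'i r]) (simp add: lookup_add)
  \<comment> \<open>The slack in \<open>linear_form_cancel\<close> absorbs \<open>g' * r\<close>,
    which is free of \<open>x_i\<close>. Once \<open>V\<close> lies in the ideal, so does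
    \<open>g' * r\<close>, and \<open>g'\<close> is monic in \<open>x_j\<close>.\<close>
  then have "g' * r - (g' * r - ?f * V) \<in> supported (\<lambda>b. Q b \<or> lookup b i = 0)"
    by (intro supported_diff supported_mono[OF gr]) (auto elim: supported_mono)
  then have "V \<in> supported Q"
    by (intro linear_form_cancel[OF up Qi]) auto
  then have "(g' * r - ?f * V) + ?f * V \<in> supported Q"
    by (intro supported_add gr supported_mult_right up)
  then have "r \<in> supported Q"
    by (intro monic_cancel[OF up Qj h]) (auto simp: g'_def elim: supported_mono)
  then show ?thesis
    using u by (intro exI[of _ w]) simp
qed


text \<open>\<open>f (w C - w D)\<close> vanishes modulo \<open>Q C \<or> Q D\<close>; when some \<open>x\<^sub>j\<close> is free for both \<open>Q C\<close> and \<open>Q D\<close>,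
  \<open>f\<close> is monic in \<open>x\<^sub>j\<close> and can be cancelled.\<close>

lemma glue_division:
  fixes u :: "('v::finite, 'k::field) mpoly" and Q :: "'i \<Rightarrow> ('v \<Rightarrow>\<^sub>0 nat) \<Rightarrow> bool"
  assumes fin: "finite M"
    and up: "\<And>C. C \<in> M \<Longrightarrow> upclosed (Q C)"
    and link: "\<And>C D. C \<in> M \<Longrightarrow> D \<in> M \<Longrightarrow> N C D \<Longrightarrow>
      \<exists>j. \<forall>a. (Q C (a + single j 1) \<longrightarrow> Q C a) \<and> (Q D (a + single j 1) \<longrightarrow> Q D a)"
    and conn: "\<And>a C D. C \<in> M \<Longrightarrow> D \<in> M \<Longrightarrow> \<not> Q C a \<Longrightarrow> \<not> Q D a \<Longrightarrow>
      \<exists>E\<in>M. \<not> Q E a \<and> N C E \<and> N E D"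
    and loc: "\<And>C. C \<in> M \<Longrightarrow> \<exists>w. u - linear_form * w \<in> supported (Q C)"
  shows "\<exists>w. u - linear_form * w \<in> supported (\<lambda>a. \<forall>C\<in>M. Q C a)"
proof -
  obtain w where w: "u - linear_form * w C \<in> supported (Q C)" if "C \<in> M" for C
    using loc by metis
  have adj: "lookup (w C) a = lookup (w D) a"
    if CD: "C \<in> M" "D \<in> M" "N C D" and a: "\<not> Q C a" "\<not> Q D a" for C D a
  proof -
    obtain j where j: "\<And>a. Q C (a + single j 1) \<Longrightarrow> Q C a" "\<And>a. Q D (a + single j 1) \<Longrightarrow> Q D a"
      using link[OF CD] by blast
    have "(u - linear_form * w D) - (u - linear_form * w C)
        \<in> supported (\<lambda>b. (Q C b \<or> Q D b) \<or> lookup b j = 0)"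
      by (intro supported_diff[OF supported_mono[OF w[OF CD(2)]] supported_mono[OF w[OF CD(1)]]]) auto
    then have "linear_form * (w C - w D) \<in> supported (\<lambda>b. (Q C b \<or> Q D b) \<or> lookup b j = 0)"
      by (simp add: algebra_simps)
    moreover have "upclosed (\<lambda>b. Q C b \<or> Q D b)"
      using up[OF CD(1)] up[OF CD(2)] unfolding upclosed_def by blast
    ultimately have "w C - w D \<in> supported (\<lambda>b. Q C b \<or> Q D b)"
      using j by (intro linear_form_cancel[of "\<lambda>b. Q C b \<or> Q D b" j]) blast+
    then show ?thesis
      using a by (auto simp: supported_def lookup_minus)
  qed
  have eq: "lookup (w C) a = lookup (w D) a"
    if "C \<in> M" "D \<in> M" "\<not> Q C a" "\<not> Q D a" for C D a
    using conn[OF that] adj that by metis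
  \<comment> \<open>At each exponent the quotients of all failing \<open>C\<close> agree, so any of
    them may supply the coefficient. Where none fails the value is immaterial, and 0 keeps the
    support finite.\<close>
  define c where "c a = (if \<exists>C\<in>M. \<not> Q C a then lookup (w (SOME C. C \<in> M \<and> \<not> Q C a)) a else 0)" for a
  have c: "c a = lookup (w C) a" if "C \<in> M" "\<not> Q C a" for C a
  proof -
    have "(SOME C. C \<in> M \<and> \<not> Q C a) \<in> M \<and> \<not> Q (SOME C. C \<in> M \<and> \<not> Q C a) a"
      using that by (intro someI[of "\<lambda>C. C \<in> M \<and> \<not> Q C a" C]) auto
    then show ?thesis
      using that by (auto simp: c_def intro: eq)
  qed
  have "{a. c a \<noteq> 0} \<subseteq> (\<Union>C\<in>M. keys (w C))"
  proof
    fix a assume "a \<in> {a. c a \<noteq> 0}"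
    then obtain C where "C \<in> M" "\<not> Q C a" "c a \<noteq> 0"
      by (auto simp: c_def split: if_splits)
    then show "a \<in> (\<Union>C\<in>M. keys (w C))"
      using c[of C a] by (auto simp: in_keys_iff)
  qed
  then have "finite {a. c a \<noteq> 0}"
    by (rule finite_subset) (use fin in auto)
  then have W: "lookup (Abs_poly_mapping c) = c"
    by simp
  have "u - linear_form * Abs_poly_mapping c \<in> supported (Q C)" if C: "C \<in> M" for C
  proof -
    have "w C - Abs_poly_mapping c \<in> supported (Q C)"
      using c[OF C] by (fastforce simp: supported_def lookup_minus W)
    then have "(u - linear_form * w C) + linear_form * (w C - Abs_poly_mapping c) \<in> supported (Q C)"
      by (intro supported_add w[OF C] supported_mult_right up[OF C])
    then show ?thesis
      by (simp add: algebra_simps)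
  qed
  then show ?thesis
    by (auto simp: supported_def intro!: exI[of _ "Abs_poly_mapping c"])
qed

section \<open>Obstruction to regular pairs\<close>

lemma supported_disjE:
  fixes f :: "('v, 'k::field) mpoly"
  assumes "f \<in> supported (\<lambda>a. P a \<or> Q a)"
  obtains p q where "f = p + q" "p \<in> supported P" "q \<in> supported Q"
proof -
  define c where "c a = (if P a then lookup f a else 0)" for a
  have "{a. c a \<noteq> 0} \<subseteq> keys f"
    by (auto simp: c_def in_keys_iff)
  then have "finite {a. c a \<noteq> 0}"
    by (rule finite_subset) simp
  then have c: "lookup (Abs_poly_mapping c) = c"
    by simp
  show ?thesis
  proof (rule that[of "Abs_poly_mapping c" "f - Abs_poly_mapping c"])
    show "f - Abs_poly_mapping c \<in> supported Q"
      using assms by (auto simp: supported_def lookup_minus c c_def)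
  qed (auto simp: supported_def c c_def)
qed

text \<open>If \<open>f = p + q\<close> and \<open>g = p' + q'\<close> with \<open>p, p' \<in> (x\<^sub>i | i \<in> A)\<close> and \<open>q, q' \<in> (x\<^sub>j | j \<in> B)\<close>, then
  \<open>g x\<^sup>a p = f x\<^sup>a p'\<close> modulo \<open>J\<close>, so \<open>x\<^sup>a p = f w\<close> for some \<open>w\<close>. Away from the origin, \<open>w\<close> has to
  agree with \<open>x\<^sup>a\<close> on one component and with \<open>0\<close> on the other one.\<close>

lemma not_regular_pair:
  fixes f g :: "('v, 'k::field) mpoly"
  assumes up: "upclosed E" and AB: "A \<union> B = UNIV" "A \<noteq> {}" "B \<noteq> {}"
    and aA: "\<And>i. i \<in> A \<Longrightarrow> \<not> E (single i 1 + a)" and aB: "\<And>j. j \<in> B \<Longrightarrow> \<not> E (single j 1 + a)"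
    and aAB: "\<And>b i j. i \<in> A \<Longrightarrow> lookup b i > 0 \<Longrightarrow> j \<in> B \<Longrightarrow> lookup b j > 0 \<Longrightarrow> E (b + a)"
    and f0: "lookup f 0 = 0" and g0: "lookup g 0 = 0"
    and nzd: "\<And>r. f * r \<in> supported E \<Longrightarrow> r \<in> supported E"
    and reg: "\<And>u v. g * u - f * v \<in> supported E \<Longrightarrow> \<exists>w. u - f * w \<in> supported E"
  shows False
proof -
  define PA where "PA b \<longleftrightarrow> (\<exists>i\<in>A. lookup b i > 0)" for b :: "'v \<Rightarrow>\<^sub>0 nat"
  define PB where "PB b \<longleftrightarrow> (\<exists>j\<in>B. lookup b j > 0)" for b :: "'v \<Rightarrow>\<^sub>0 nat"
  define X where "X = (single a 1 :: ('v, 'k) mpoly)"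
  have PAB: "PA b \<or> PB b" if b: "b \<noteq> 0" for b
  proof -
    obtain i where "lookup b i \<noteq> 0"
      using b by (metis lookup_zero poly_mapping_eqI)
    then show ?thesis
      using AB(1) unfolding PA_def PB_def by blast
  qed
  have split: "h \<in> supported (\<lambda>b. PA b \<or> PB b)" if "lookup h 0 = 0" for h :: "('v, 'k) mpoly"
    unfolding supported_def mem_Collect_eq
  proof (intro allI impI)
    fix b assume "lookup h b \<noteq> 0"
    then have "b \<noteq> 0"
      using that by metis
    then show "PA b \<or> PB b"
      by (rule PAB)
  qed
  obtain p q where f: "f = p + q" "p \<in> supported PA" "q \<in> supported PB"
    using split[OF f0] by (rule supported_disjE)
  obtain p' q' where g: "g = p' + q'" "p' \<in> supported PA" "q' \<in> supported PB"
    using split[OF g0] by (rule supported_disjE)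
  have X: "X * (s * r) \<in> supported E" if "s \<in> supported PA" "r \<in> supported PB" for s r
  proof -
    have "s * r \<in> supported (\<lambda>b. PA b \<and> PB b)"
      using that by (rule supported_mult) (auto simp: PA_def PB_def lookup_add)
    moreover have "X \<in> supported (\<lambda>b. b = a)"
      unfolding X_def by (rule supported_single) simp
    ultimately have "(s * r) * X \<in> supported E"
      by (rule supported_mult) (auto simp: PA_def PB_def intro: aAB)
    then show ?thesis
      by (simp only: mult.commute)
  qed
  have "X * (p * q') - X * (p' * q) \<in> supported E"
    by (intro supported_diff X f g)
  also have "X * (p * q') - X * (p' * q) = g * (X * p) - f * (X * p')"
    unfolding f(1) g(1) by (simp add: algebra_simps)
  finally obtain w where "X * p - f * w \<in> supported E"
    using reg by blast
  then have w: "f * w - X * p \<in> supported E"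
    using supported_uminus by fastforce
  have var: "var i \<in> supported PA" if "i \<in> A" for i
    using that unfolding var_def PA_def by (intro supported_single bexI[of _ i]) auto
  have var': "var j \<in> supported PB" if "j \<in> B" for j
    using that unfolding var_def PB_def by (intro supported_single bexI[of _ j]) auto
  obtain i j where ij: "i \<in> A" "j \<in> B"
    using AB by blast
  \<comment> \<open>For \<open>i\<close> in \<open>A\<close>, \<open>x_i x^a q\<close> vanishes
    modulo \<open>E\<close>, so \<open>f\<close> can be cancelled from
    \<open>f x_i (w - x^a)\<close>. As \<open>x_i x^a\<close> is not in \<open>E\<close>, the
    coefficient of \<open>w\<close> at \<open>a\<close> is 1.\<close>
  have "var i * (f * w - X * p) - X * (var i * q) \<in> supported E"
    by (intro supported_diff X supported_mult_right up w var ij f)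
  then have "f * (var i * w - var i * X) \<in> supported E"
    unfolding f(1) by (simp add: algebra_simps)
  then have "var i * (w - X) \<in> supported E"
    using nzd by (auto simp: algebra_simps)
  then have "lookup (var i * (w - X)) (single i 1 + a) = 0"
    using aA[OF ij(1)] by (auto simp: supported_def)
  then have "lookup w a = 1"
    unfolding var_def lookup_single_mult by (simp add: lookup_minus X_def)
  \<comment> \<open>For \<open>j\<close> in \<open>B\<close> it is \<open>x_j x^a p\<close> that
    vanishes, which makes the same coefficient 0.\<close>
  moreover have "var j * (f * w - X * p) + X * (p * var j) \<in> supported E"
    by (intro supported_add X supported_mult_right up w var' ij f)
  then have "f * (var j * w) \<in> supported E"
    by (simp add: algebra_simps)
  then have "var j * w \<in> supported E"
    by (rule nzd)
  then have "lookup (var j * w) (single j 1 + a) = 0"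
    using aB[OF ij(2)] by (auto simp: supported_def)
  then have "lookup w a = 0"
    unfolding var_def lookup_single_mult by simp
  ultimately show False
    by simp
qed

section \<open>Regular sequences and depth\<close>

lemma ideal_gen_self: "ideal.subspace J \<Longrightarrow> ideal_gen J = J"
  by simp

lemma ideal_gen_union_singleton:
  assumes "ideal.subspace J"
  shows "ideal_gen (J \<union> {f}) = {u. \<exists>w. u - f * w \<in> J}"
  using ideal.span_insert[of f J] by (simp add: mult.commute[of f] ideal_gen_self[OF assms])

lemma regular_seq_singleton_iff:
  assumes "ideal.subspace J"
  shows "regular_seq_on_quotient J [f] \<longleftrightarrow>
    (\<forall>g. f * g \<in> J \<longrightarrow> g \<in> J) \<and> ideal_gen (J \<union> {f}) \<noteq> UNIV"
  by (simp add: regular_seq_on_quotient_def ideal_gen_self[OF assms])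

lemma regular_seq_pair_iff:
  assumes "ideal.subspace J"
  shows "regular_seq_on_quotient J [f, g] \<longleftrightarrow>
    (\<forall>u. f * u \<in> J \<longrightarrow> u \<in> J) \<and>
    (\<forall>u v. g * u - f * v \<in> J \<longrightarrow> (\<exists>w. u - f * w \<in> J)) \<and> ideal_gen (J \<union> {f, g}) \<noteq> UNIV"
proof -
  have all: "(\<forall>i<length [f, g]. P i) \<longleftrightarrow> P 0 \<and> P 1" for P :: "nat \<Rightarrow> bool"
    by (auto simp: less_Suc_eq)
  show ?thesis
    unfolding regular_seq_on_quotient_def all
    using ideal_gen_union_singleton[OF assms, of f] by (auto simp: ideal_gen_self[OF assms])
qed

text \<open>Regularity passes to an initial segment, so excluding regular pairs suffices to bound
  the depth by 1.\<close>

lemma regular_seq_take2: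
  assumes "regular_seq_on_quotient J fs" "length fs \<ge> 2"
  shows "regular_seq_on_quotient J [fs ! 0, fs ! 1]"
proof -
  obtain f g hs where fs: "fs = f # g # hs"
    using assms(2) by (metis Suc_le_length_iff numeral_2_eq_2)
  have "regular_seq_on_quotient J [f, g]"
    unfolding regular_seq_on_quotient_def
  proof (intro conjI allI impI)
    fix i h assume i: "i < length [f, g]" "[f, g] ! i * h \<in> ideal_gen (J \<union> set (take i [f, g]))"
    then have "i = 0 \<or> i = 1"
      by auto
    then have "i < length fs" "fs ! i = [f, g] ! i" "take i fs = take i [f, g]"
      unfolding fs by auto
    then show "h \<in> ideal_gen (J \<union> set (take i [f, g]))"
      using assms(1) i(2) unfolding regular_seq_on_quotient_def by metis
  next
    have "ideal_gen (J \<union> set [f, g]) \<subseteq> ideal_gen (J \<union> set fs)"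
      unfolding fs by (intro ideal.span_mono) auto
    then show "ideal_gen (J \<union> set [f, g]) \<noteq> UNIV"
      using assms(1) unfolding regular_seq_on_quotient_def by blast
  qed
  then show ?thesis
    by (simp add: fs)
qed

lemma upclosed_nonzero: "upclosed (\<lambda>a :: 'v \<Rightarrow>\<^sub>0 nat. a \<noteq> 0)"
  by (auto simp: upclosed_def poly_mapping_eq_iff lookup_add fun_eq_iff)

lemma irrelevant_ideal_subset: "irrelevant_ideal \<subseteq> supported (\<lambda>a. a \<noteq> 0)"
  unfolding irrelevant_ideal_def
  by (intro ideal.span_minimal subspace_supported upclosed_nonzero)
    (auto simp: var_def poly_mapping_eq_iff fun_eq_iff lookup_single when_def intro!: supported_single)

lemma irrelevant_lookup_zero: "f \<in> irrelevant_ideal \<Longrightarrow> lookup f 0 = 0"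
  using irrelevant_ideal_subset by (auto simp: supported_def)

lemma ideal_gen_proper:
  fixes S :: "('v, 'k::field) mpoly set"
  assumes "S \<subseteq> supported (\<lambda>a. a \<noteq> 0)"
  shows "ideal_gen S \<noteq> UNIV"
proof
  assume "ideal_gen S = UNIV"
  moreover have "ideal_gen S \<subseteq> supported (\<lambda>a. a \<noteq> 0)"
    by (intro ideal.span_minimal subspace_supported upclosed_nonzero assms)
  ultimately have "(1 :: ('v, 'k) mpoly) \<in> supported (\<lambda>a. a \<noteq> 0)"
    by auto
  then show False
    by (auto simp: supported_def lookup_one)
qed

lemma linear_form_in_irrelevant: "linear_form \<in> irrelevant_ideal"
  unfolding linear_form_def irrelevant_ideal_def
  by (intro ideal.span_sum ideal.span_base) auto

lemma power_form_in_irrelevant: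
  assumes "\<And>l. e l > 0"
  shows "power_form e \<in> irrelevant_ideal"
proof -
  have "var l ^ e l \<in> irrelevant_ideal" for l
    using ideal.span_scale[OF ideal.span_base[of "var l" "range var"], of "var l ^ (e l - 1)"] assms[of l]
    unfolding irrelevant_ideal_def by (simp flip: power_Suc2)
  then show ?thesis
    unfolding power_form_def irrelevant_ideal_def by (intro ideal.span_sum)
qed

lemma depth_quotient_ge:
  assumes "set fs \<subseteq> irrelevant_ideal" "regular_seq_on_quotient J fs"
  shows "enat (length fs) \<le> depth_quotient J"
  unfolding depth_quotient_def using assms by (intro Sup_upper) auto

lemma depth_quotient_le:
  assumes "\<And>fs. set fs \<subseteq> irrelevant_ideal \<Longrightarrow> regular_seq_on_quotient J fs \<Longrightarrow> length fs \<le> n"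
  shows "depth_quotient J \<le> enat n"
  unfolding depth_quotient_def using assms by (intro Sup_least) auto


section \<open>Vertex covers and powers of the edge ideal\<close>

text \<open>Otherwise \<open>S\<close> would be closed under arcs and contain everything reachable
  from its elements.\<close>

lemma connected_cut:
  assumes "connected (with_proj G)" and "pverts G = UNIV"
    and sym: "\<And>u v. (u, v) \<in> parcs G \<Longrightarrow> (v, u) \<in> parcs G"
    and S: "S \<noteq> {}" "S \<noteq> UNIV"
  shows "\<exists>u v. (u, v) \<in> parcs G \<and> u \<in> S \<and> v \<notin> S"
proof (rule ccontr)
  assume "\<not> ?thesis"
  then have closed: "v \<in> S" if "(u, v) \<in> parcs G" "u \<in> S" for u v
    using that by blast
  obtain x y where "x \<in> S" "y \<notin> S"
    using S by blast
  have "(x, y) \<in> rtrancl_on UNIV (symcl (parcs G))"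
    using assms(1,2) connected_conv[of "with_proj G"] by simp
  then have "y \<in> S"
  proof (induction rule: rtrancl_on_induct)
    case (step y z)
    then have "(y, z) \<in> parcs G"
      using sym by (auto simp: symcl_def)
    then show ?case
      using closed step by blast
  qed (use \<open>x \<in> S\<close> in simp)
  then show False
    using \<open>y \<notin> S\<close> by simp
qed

section \<open>Weights and minimal vertex covers\<close>

definition weight :: "'v set \<Rightarrow> ('v \<Rightarrow>\<^sub>0 nat) \<Rightarrow> nat" where
  "weight C a = (\<Sum>v\<in>C. lookup a v)"

lemma weight_add: "weight C (a + b) = weight C a + weight C b"
  by (simp add: weight_def lookup_add sum.distrib)

lemma weight_single: "weight C (single (i :: 'v::finite) n) = (if i \<in> C then n else 0)"
  by (simp add: weight_def lookup_single when_def)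

lemma weight_mono: "C \<subseteq> D \<Longrightarrow> weight C a \<le> weight (D :: 'v::finite set) a"
  unfolding weight_def by (rule sum_mono2) auto

lemma weight_ge_lookup: "i \<in> C \<Longrightarrow> lookup a i \<le> weight (C :: 'v::finite set) a"
  unfolding weight_def by (rule member_le_sum) auto

lemma upclosed_weight: "upclosed (\<lambda>a. t \<le> weight C a)"
  by (auto simp: upclosed_def weight_add)

lemma weight_add_single_outside: "i \<notin> C \<Longrightarrow> weight C (a + single (i :: 'v::finite) n) = weight C a"
  by (simp add: weight_add weight_single)

locale connected_bipartite_graph =
  fixes G :: "'v::finite pair_pre_digraph" and A B :: "'v set"
  assumes graph: "pair_graph G" and verts: "pverts G = UNIV" and card_verts: "card (pverts G) \<ge> 2"
    and connected: "connected (with_proj G)" and bip: "bipartition G A B"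
begin

abbreviation "Covers \<equiv> min_vertex_covers G"

lemma parts: "A \<union> B = UNIV" "A \<inter> B = {}"
  using bip verts by (auto simp: bipartition_def)

lemma arc_parts: "(u, v) \<in> parcs G \<Longrightarrow> (u \<in> A \<and> v \<in> B) \<or> (u \<in> B \<and> v \<in> A)"
  using bip by (auto simp: bipartition_def)

lemma arc_sym: "(u, v) \<in> parcs G \<Longrightarrow> (v, u) \<in> parcs G"
  using pair_sym_digraph.arcs_symmetric[of G] pair_graph.axioms(2)[OF graph]
    pair_pseudo_graph.axioms(2) by blast

lemma swap: "connected_bipartite_graph G B A"
proof (rule connected_bipartite_graph.intro)
  show "bipartition G B A"
    using bip unfolding bipartition_def by blast
qed (use graph verts card_verts connected in blast)+

lemma vertex_cover_iff:
  "vertex_cover G C \<longleftrightarrow> (\<forall>u\<in>A. \<forall>v\<in>B. (u, v) \<in> parcs G \<longrightarrow> u \<in> C \<or> v \<in> C)"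
  using arc_parts arc_sym verts unfolding vertex_cover_def by fast

lemma neighbor: obtains v where "(u, v) \<in> parcs G"
proof -
  have "{u} \<noteq> UNIV"
    using card_verts verts by (metis One_nat_def card.empty card.insert empty_iff finite.emptyI
      not_less_eq_eq numeral_2_eq_2 order_refl)
  then show ?thesis
    using connected_cut[OF connected verts arc_sym, of "{u}"] that by blast
qed

lemma part_nonempty: "A \<noteq> {}"
  using neighbor arc_parts by (metis empty_iff)

lemma min_vertex_cover_below:
  assumes "vertex_cover G C"
  obtains D where "D \<in> Covers" "D \<subseteq> C"
proof -
  have "\<exists>D\<in>Covers. D \<subseteq> C"
    using finite[of C] assms
  proof (induction C rule: finite_psubset_induct)
    case (psubset C)
    show ?case
    proof (cases "C \<in> Covers")
      case False
      then obtain D where D: "D \<subset> C" "vertex_cover G D"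
        using psubset.prems by (auto simp: min_vertex_covers_def)
      obtain E where "E \<in> Covers" "E \<subseteq> D"
        using psubset.IH[OF D] by blast
      then show ?thesis
        using D by blast
    qed (rule bexI[of _ C], simp_all)
  qed
  then show ?thesis
    using that by blast
qed

lemma vertex_cover_part: "vertex_cover G A"
  by (auto simp: vertex_cover_iff)

text \<open>A vertex of \<open>A\<close> cannot be dropped: it has a neighbour in \<open>B\<close>,
  and the edge between them would be uncovered.\<close>

lemma min_vertex_cover_part: "A \<in> Covers"
proof -
  have "\<not> D \<subset> A" if D: "vertex_cover G D" for D
  proof
    assume "D \<subset> A"
    then obtain u where u: "u \<in> A" "u \<notin> D"
      by blast
    obtain v where "(u, v) \<in> parcs G"
      by (rule neighbor)
    then have "v \<in> B" "v \<in> D"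
      using arc_parts[of u v] parts(2) u D unfolding vertex_cover_iff by blast+
    then show False
      using \<open>D \<subset> A\<close> parts(2) by blast
  qed
  then show ?thesis
    using vertex_cover_part by (auto simp: min_vertex_covers_def)
qed

lemma min_vertex_coverD: "C \<in> Covers \<Longrightarrow> vertex_cover G C"
  by (simp add: min_vertex_covers_def)

lemma min_vertex_cover_superset_part: "C \<in> Covers \<Longrightarrow> A \<subseteq> C \<Longrightarrow> C = A"
  using vertex_cover_part by (auto simp: min_vertex_covers_def)

end

text \<open>The hypotheses are symmetric in the parts, so the facts about \<open>A\<close> proved so
  far hold for \<open>B\<close> under the prefix \<open>swapped\<close>.\<close>

sublocale connected_bipartite_graph \<subseteq> swapped: connected_bipartite_graph G B A
  by (rule swap)

section \<open>The lattice of vertex covers and the powers of the edge ideal\<close>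

context connected_bipartite_graph
begin

lemma min_vertex_cover_not_UNIV: "C \<in> Covers \<Longrightarrow> C \<noteq> UNIV"
  using min_vertex_cover_superset_part[of C] parts(2) swapped.part_nonempty by blast

text \<open>Mixing union on one part with intersection on the other keeps every edge covered, unlike
  plain intersection, and \<open>join\<close> and \<open>meet\<close> together preserve the total
  weight.\<close>

definition join :: "'v set \<Rightarrow> 'v set \<Rightarrow> 'v set" where
  "join C D = ((C \<union> D) \<inter> A) \<union> (C \<inter> D \<inter> B)"

definition meet :: "'v set \<Rightarrow> 'v set \<Rightarrow> 'v set" where
  "meet C D = ((C \<union> D) \<inter> B) \<union> (C \<inter> D \<inter> A)"

lemma vertex_cover_join: "vertex_cover G C \<Longrightarrow> vertex_cover G D \<Longrightarrow> vertex_cover G (join C D)"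
  unfolding vertex_cover_iff join_def by blast

lemma vertex_cover_meet: "vertex_cover G C \<Longrightarrow> vertex_cover G D \<Longrightarrow> vertex_cover G (meet C D)"
  unfolding vertex_cover_iff meet_def by blast

lemma weight_join_meet: "weight (join C D) a + weight (meet C D) a = weight C a + weight D a"
proof -
  have w: "weight X a = (\<Sum>v\<in>UNIV. if v \<in> X then lookup a v else 0)" for X
    unfolding weight_def by (simp add: sum.If_cases)
  have "(if v \<in> join C D then lookup a v else 0) + (if v \<in> meet C D then lookup a v else 0)
      = (if v \<in> C then lookup a v else 0) + (if v \<in> D then lookup a v else 0)" for v
  proof -
    have "v \<in> A \<and> v \<notin> B \<or> v \<in> B \<and> v \<notin> A"
      using parts by blast
    then show ?thesis
      by (auto simp: join_def meet_def)
  qed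
  then show ?thesis
    unfolding w sum.distrib[symmetric] by (intro sum.cong) auto
qed

text \<open>The exponents of the \<open>t\<close>-th symbolic power: \<open>x^a\<close> lies in
  \<open>P_C^t\<close> iff \<open>t \<le> weight C a\<close>.\<close>

definition cover_bound :: "nat \<Rightarrow> ('v \<Rightarrow>\<^sub>0 nat) \<Rightarrow> bool" where
  "cover_bound t a \<longleftrightarrow> (\<forall>C\<in>Covers. t \<le> weight C a)"

lemma cover_boundD: "cover_bound t a \<Longrightarrow> vertex_cover G C \<Longrightarrow> t \<le> weight C a"
  unfolding cover_bound_def by (meson min_vertex_cover_below weight_mono order_trans)

lemma upclosed_cover_bound: "upclosed (cover_bound t)"
  unfolding upclosed_def cover_bound_def by (metis weight_add trans_le_add1)

text \<open>If each edge \<open>uv\<close> in the support of \<open>a\<close> were contained in a vertex cover of weight \<open>t + 1\<close>,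
  then for a fixed \<open>v\<close> the join of those covers would contain \<open>v\<close> together with all its neighbours
  in the support, and removing \<open>v\<close> would give a cover of weight at most \<open>t\<close>.\<close>

lemma edge_reduction:
  assumes a: "cover_bound (Suc t) a"
  shows "\<exists>u v. (u, v) \<in> parcs G \<and> lookup a u \<ge> 1 \<and> lookup a v \<ge> 1 \<and>
    cover_bound t (a - single u 1 - single v 1)"
proof (rule ccontr)
  assume "\<not> ?thesis"
  then have no: "\<not> cover_bound t (a - single u 1 - single v 1)"
    if "(u, v) \<in> parcs G" "lookup a u \<ge> 1" "lookup a v \<ge> 1" for u v
    using that by blast
  define T where "T = {C. vertex_cover G C \<and> weight C a = Suc t}"
  \<comment> \<open>Removing \<open>uv\<close> lowers the weight of a cover by the number of ends it
    contains. A drop from at least \<open>t + 1\<close> to below \<open>t\<close> needs both ends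
    and weight exactly \<open>t + 1\<close>.\<close>
  have tight: "\<exists>C\<in>T. u \<in> C \<and> v \<in> C"
    if uv: "u \<in> A" "v \<in> B" "(u, v) \<in> parcs G" "lookup a u \<ge> 1" "lookup a v \<ge> 1" for u v
  proof -
    define a' where "a' = a - single u 1 - single v 1"
    have "u \<noteq> v"
      using uv parts by blast
    then have a_eq: "a = a' + single u 1 + single v 1"
      using uv by (intro poly_mapping_eqI)
        (auto simp: a'_def lookup_add lookup_minus lookup_single when_def)
    obtain C where C: "C \<in> Covers" "weight C a' < t"
      using no[OF uv(3-5)] unfolding cover_bound_def a'_def by force
    have "weight C a = weight C a' + (if u \<in> C then 1 else 0) + (if v \<in> C then 1 else 0)"
      unfolding a_eq by (simp add: weight_add weight_single)
    moreover have "Suc t \<le> weight C a"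
      using a C(1) by (simp add: cover_bound_def)
    ultimately show ?thesis
      using C min_vertex_coverD[OF C(1)] by (auto simp: T_def split: if_splits)
  qed
  \<comment> \<open>Otherwise the vertices outside the support of \<open>a\<close> would form a
    cover of weight 0.\<close>
  have "\<exists>u v. u \<in> A \<and> v \<in> B \<and> (u, v) \<in> parcs G \<and> lookup a u \<ge> 1 \<and> lookup a v \<ge> 1"
  proof (rule ccontr)
    assume "\<not> ?thesis"
    then have "\<forall>u\<in>A. \<forall>v\<in>B. (u, v) \<in> parcs G \<longrightarrow> \<not> lookup a u \<ge> 1 \<or> \<not> lookup a v \<ge> 1"
      by blast
    then have "vertex_cover G {v. lookup a v = 0}"
      unfolding vertex_cover_iff by (simp add: not_less_eq_eq)
    then have "Suc t \<le> weight {v. lookup a v = 0} a"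
      by (rule cover_boundD[OF a])
    then show False
      by (simp add: weight_def)
  qed
  then obtain u0 v where v: "v \<in> B" "lookup a v \<ge> 1"
    and u0: "u0 \<in> A" "(u0, v) \<in> parcs G" "lookup a u0 \<ge> 1"
    by blast
  define U where "U = {u \<in> A. (u, v) \<in> parcs G \<and> lookup a u \<ge> 1}"
  have "\<exists>C\<in>T. v \<in> C \<and> W \<subseteq> C" if "W \<subseteq> U" "W \<noteq> {}" for W
    using finite[of W] that(2,1)
  proof (induction W rule: finite_ne_induct)
    case (singleton u)
    then show ?case
      using tight[of u v] v by (auto simp: U_def)
  next
    case (insert u W)
    obtain C where C: "C \<in> T" "v \<in> C" "W \<subseteq> C"
      using insert by auto
    obtain D where D: "D \<in> T" "u \<in> D" "v \<in> D"
      using tight[of u v] v insert by (auto simp: U_def)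
    have CD: "vertex_cover G C" "vertex_cover G D"
      using C D by (simp_all add: T_def)
    have "Suc t \<le> weight (join C D) a" "Suc t \<le> weight (meet C D) a"
      by (rule cover_boundD[OF a vertex_cover_join[OF CD]])
        (rule cover_boundD[OF a vertex_cover_meet[OF CD]])
    then have "weight (join C D) a = Suc t"
      using weight_join_meet[of C D a] C D by (auto simp: T_def)
    then have "join C D \<in> T"
      using vertex_cover_join[OF CD] by (simp add: T_def)
    moreover have "v \<in> join C D" "insert u W \<subseteq> join C D"
      using C D v insert by (auto simp: join_def U_def)
    ultimately show ?case
      by blast
  qed
  from this[of U] obtain C where C: "C \<in> T" "v \<in> C" "U \<subseteq> C"
    using u0 by (auto simp: U_def)
  \<comment> \<open>Neighbours of \<open>v\<close> outside \<open>U\<close> have exponent 0, so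
    adding them covers the remaining edges at \<open>v\<close> without adding weight.\<close>
  define Z where "Z = {u. lookup a u = 0}"
  have "vertex_cover G (C - {v} \<union> Z)"
    unfolding vertex_cover_iff
  proof (intro ballI impI)
    fix x y assume xy: "x \<in> A" "y \<in> B" "(x, y) \<in> parcs G"
    then have "x \<noteq> v"
      using v parts by blast
    moreover have "x \<in> C \<or> y \<in> C"
      using C xy unfolding T_def vertex_cover_iff by blast
    moreover have "x \<in> C \<or> x \<in> Z" if "y = v"
      using C(3) xy that by (force simp: U_def Z_def)
    ultimately show "x \<in> C - {v} \<union> Z \<or> y \<in> C - {v} \<union> Z"
      by blast
  qed
  then have "Suc t \<le> weight (C - {v} \<union> Z) a"
    by (rule cover_boundD[OF a])
  also have "\<dots> \<le> weight (C - {v}) a + weight Z a"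
    unfolding weight_def by (metis finite le_add1 sum.union_inter)
  also have "weight Z a = 0"
    by (simp add: weight_def Z_def)
  also have "weight (C - {v}) a < Suc t"
    using C v sum.remove[of C v "lookup a"] by (simp add: T_def weight_def)
  finally show False
    by simp
qed

text \<open>Ordinary and symbolic powers agree: one inclusion adds up weights, the other splits off
  one edge at a time by \<open>edge_reduction\<close>.\<close>

lemma ideal_power_edge_ideal:
  "ideal_power (edge_ideal G :: ('v, 'k::field) mpoly set) t = supported (cover_bound t)"
proof
  let ?I = "edge_ideal G :: ('v, 'k) mpoly set"
  have I: "?I \<subseteq> supported (cover_bound 1)"
    unfolding edge_ideal_def
  proof (intro ideal.span_minimal subspace_supported upclosed_cover_bound subsetI)
    fix p :: "('v, 'k) mpoly"
    assume "p \<in> {var u * var v |u v. (u, v) \<in> parcs G}"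
    then obtain u v where uv: "p = var u * var v" "(u, v) \<in> parcs G"
      by blast
    have "1 \<le> weight C (single u 1 + single v 1)" if "C \<in> Covers" for C
      using min_vertex_coverD[OF that] uv(2)
      by (auto simp: weight_add weight_single vertex_cover_def)
    then show "p \<in> supported (cover_bound 1)"
      unfolding uv(1) var_def mult_single
      by (intro supported_single) (simp add: cover_bound_def)
  qed
  show "ideal_power ?I t \<subseteq> supported (cover_bound t)"
  proof (induction t)
    case (Suc t)
    have "p * q \<in> supported (cover_bound (Suc t))" if "p \<in> ?I" "q \<in> ideal_power ?I t" for p q
    proof (rule supported_mult)
      show "p \<in> supported (cover_bound 1)" "q \<in> supported (cover_bound t)"
        using that I Suc by auto
      show "cover_bound (Suc t) (a + b)" if "cover_bound 1 a" "cover_bound t b" for a b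
        using that unfolding cover_bound_def weight_add
        by (metis add_mono plus_1_eq_Suc)
    qed
    then show ?case
      unfolding ideal_power.simps ideal_mult_def
      by (intro ideal.span_minimal subspace_supported upclosed_cover_bound) blast
  qed (auto simp: supported_def cover_bound_def)
  have mono: "single a c \<in> ideal_power ?I t" if "cover_bound t a" for a and c :: 'k
    using that
  proof (induction t arbitrary: a)
    case (Suc t)
    obtain u v where uv: "(u, v) \<in> parcs G" "lookup a u \<ge> 1" "lookup a v \<ge> 1"
      "cover_bound t (a - single u 1 - single v 1)"
      using edge_reduction[OF Suc.prems] by blast
    have "u \<noteq> v"
      using arc_parts[OF uv(1)] parts(2) by blast
    then have "a = single u 1 + single v 1 + (a - single u 1 - single v 1)"
      using uv by (intro poly_mapping_eqI) (auto simp: lookup_add lookup_minus lookup_single when_def)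
    then have "single a c = (var u * var v) * single (a - single u 1 - single v 1) c"
      by (simp add: var_def mult_single)
    moreover have "var u * var v \<in> ?I"
      unfolding edge_ideal_def by (rule ideal.span_base) (use uv in blast)
    ultimately show ?case
      unfolding ideal_power.simps ideal_mult_def
      using Suc.IH[OF uv(4)] by (intro ideal.span_base) blast
  qed simp
  have subspace: "ideal.subspace (ideal_power ?I t)"
    by (cases t) (auto simp: ideal_mult_def)
  show "supported (cover_bound t) \<subseteq> ideal_power ?I t"
  proof
    fix p :: "('v, 'k) mpoly" assume p: "p \<in> supported (cover_bound t)"
    have "p = (\<Sum>a\<in>keys p. single a (lookup p a))"
      by (rule poly_mapping_eqI) (auto simp: lookup_sum lookup_single when_def in_keys_iff)
    also have "\<dots> \<in> ideal_power ?I t"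
      using p by (intro ideal.subspace_sum subspace mono) (auto simp: supported_def in_keys_iff)
    finally show "p \<in> ideal_power ?I t" .
  qed
qed

section \<open>Depth of powers\<close>

text \<open>Each minimal cover \<open>C\<close> omits a vertex \<open>j\<close>; \<open>x_j\<close>
  is free for \<open>P_C^t\<close>, and \<open>linear_form\<close> is monic in it.\<close>

lemma linear_form_nonzerodivisor:
  assumes "linear_form * r \<in> supported (cover_bound t)"
  shows "r \<in> supported (cover_bound t)"
proof -
  have "r \<in> supported (\<lambda>a. t \<le> weight C a)" if C: "C \<in> Covers" for C
  proof -
    obtain j where "j \<notin> C"
      using min_vertex_cover_not_UNIV[OF C] by blast
    then show ?thesis
      using C by (intro linear_form_cancel[OF upclosed_weight, of t C j] supported_mono[OF assms])
        (auto simp: cover_bound_def weight_add weight_single)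
  qed
  then show ?thesis
    by (auto simp: supported_def cover_bound_def)
qed

lemma sum_over_parts: "(\<Sum>i\<in>UNIV. f i) = (\<Sum>i\<in>A. f i) + (\<Sum>i\<in>B. f i :: nat)"
  using sum.union_disjoint[of A B f] parts by simp

text \<open>One vertex in each part raises the weights of \<open>A\<close> and \<open>B\<close> to
  \<open>s\<close> independently; all other covers can only gain.\<close>

lemma solution_lift:
  assumes "weight A a \<le> s" "weight B a \<le> s"
    and "\<And>C. C \<in> Covers \<Longrightarrow> C \<noteq> A \<Longrightarrow> C \<noteq> B \<Longrightarrow> s < weight C a"
  shows "\<exists>b. cover_system_solution G A B b \<and> (\<Sum>i\<in>A. b i) = s"
proof -
  obtain i j where ij: "i \<in> A" "j \<in> B"
    using part_nonempty swapped.part_nonempty by blast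
  then have ij': "i \<notin> B" "j \<notin> A"
    using parts by blast+
  define b where "b = a + single i (s - weight A a) + single j (s - weight B a)"
  have "weight A b = s" "weight B b = s"
    using ij ij' assms(1,2) by (simp_all add: b_def weight_add weight_single)
  moreover have "s < weight C b" if "C \<in> Covers" "C \<noteq> A" "C \<noteq> B" for C
    using assms(3)[OF that] by (simp add: b_def weight_add)
  ultimately show ?thesis
    by (intro exI[of _ "lookup b"]) (simp add: cover_system_solution_def flip: weight_def)
qed

text \<open>By minimality of \<open>C\<close>, dropping any \<open>w \<noteq> i\<close> uncovers an
  edge, which must be \<open>iw\<close>. So the graph is a star with centre
  \<open>i\<close>.\<close>

lemma star_covers:
  assumes C: "C \<in> Covers" "- {i} \<subseteq> C" and i: "i \<in> A" and D: "D \<in> Covers"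
  shows "D = A \<or> D = B"
proof -
  have iB: "i \<notin> B"
    using i parts by blast
  have "C \<noteq> UNIV"
    by (rule min_vertex_cover_not_UNIV[OF C(1)])
  have "i \<notin> C"
  proof
    assume "i \<in> C"
    then have "C = UNIV"
      using C(2) by auto
    then show False
      using \<open>C \<noteq> UNIV\<close> by simp
  qed
  then have Ci: "C = - {i}"
    using C(2) by auto
  have arc: "(i, w) \<in> parcs G" if "w \<noteq> i" for w
  proof -
    have "\<not> vertex_cover G (- {i, w})"
      using C(1) that unfolding Ci min_vertex_covers_def by blast
    then obtain x y where xy: "(x, y) \<in> parcs G" "x \<in> {i, w}" "y \<in> {i, w}" "x \<in> A" "y \<in> B"
      unfolding vertex_cover_iff by blast
    then show ?thesis
      using iB parts(2) by blast
  qed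
  have B: "B = - {i}"
  proof
    show "- {i} \<subseteq> B"
      using arc arc_parts iB by blast
  qed (use iB in blast)
  then have A: "A = {i}"
    using parts by blast
  show ?thesis
  proof (cases "i \<in> D")
    case True
    then show ?thesis
      using min_vertex_cover_superset_part[OF D] A by blast
  next
    case False
    have "- {i} \<subseteq> D"
      using min_vertex_coverD[OF D] arc i False unfolding vertex_cover_iff B by blast
    then show ?thesis
      using swapped.min_vertex_cover_superset_part[OF D] B by blast
  qed
qed

section \<open>Exponents \<open>t\<close> without a solution of size \<open>t - 1\<close>\<close>

context
  fixes t :: nat
  assumes t: "t \<ge> 1"
    and no_solution: "\<nexists>b. cover_system_solution G A B b \<and> (\<Sum>i\<in>A. b i) = t - 1"
begin

lemma no_solution_light_cover:
  assumes "weight A a < t" "weight B a < t"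
  shows "\<exists>C\<in>Covers. C \<noteq> A \<and> C \<noteq> B \<and> weight C a < t"
proof (rule ccontr)
  assume "\<not> ?thesis"
  then have "t - 1 < weight C a" if "C \<in> Covers" "C \<noteq> A" "C \<noteq> B" for C
    using that t by force
  moreover have "weight A a \<le> t - 1" "weight B a \<le> t - 1"
    using assms by auto
  ultimately show False
    using solution_lift[of a "t - 1"] no_solution by blast
qed

text \<open>If \<open>C \<union> D\<close> is everything, the join contains \<open>A\<close> and the
  meet contains \<open>B\<close>, so \<open>A\<close> or \<open>B\<close> is light. Each part is
  linked to every minimal cover but the other part, hence it links \<open>C\<close> and
  \<open>D\<close> unless these are \<open>A\<close> and \<open>B\<close>; then a third light cover
  does.\<close>

lemma light_covers_connected:
  assumes C: "C \<in> Covers" "weight C a < t" and D: "D \<in> Covers" "weight D a < t"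
  shows "\<exists>E\<in>Covers. weight E a < t \<and> C \<union> E \<noteq> UNIV \<and> E \<union> D \<noteq> UNIV"
proof (cases "C \<union> D = UNIV")
  case False
  then show ?thesis
    using C min_vertex_cover_not_UNIV[OF C(1)] by (intro bexI[of _ C]) auto
next
  case True
  note A = min_vertex_cover_part min_vertex_cover_superset_part
  note B = swapped.min_vertex_cover_part swapped.min_vertex_cover_superset_part
  have A_sup: "E = A" if "E \<in> Covers" "E \<union> B = UNIV" for E
    using that A(2)[of E] parts by blast
  have B_sup: "E = B" if "E \<in> Covers" "E \<union> A = UNIV" for E
    using that B(2)[of E] parts by blast
  have "A \<subseteq> join C D" "B \<subseteq> meet C D"
    using True by (auto simp: join_def meet_def)
  then have "weight A a \<le> weight (join C D) a" "weight B a \<le> weight (meet C D) a"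
    by (simp_all only: weight_mono)
  then have light: "weight A a < t \<or> weight B a < t"
    using C D weight_join_meet[of C D a] by linarith
  \<comment> \<open>\<open>X\<close> and \<open>Y\<close> are the two parts in either order. If one
    of \<open>C\<close>, \<open>D\<close> is \<open>Y\<close>, their union being everything forces
    the other to be \<open>X\<close>.\<close>
  have via: "?thesis \<or> {C, D} = {X, Y}"
    if X: "X \<in> Covers" "weight X a < t"
      and sup: "\<And>E. E \<in> Covers \<Longrightarrow> E \<union> X = UNIV \<Longrightarrow> E = Y"
        "\<And>E. E \<in> Covers \<Longrightarrow> E \<union> Y = UNIV \<Longrightarrow> E = X" for X Y
  proof (cases "C \<union> X = UNIV \<or> D \<union> X = UNIV")
    case False
    then show ?thesis
      using X by (intro disjI1 bexI[of _ X]) (simp_all add: Un_commute)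
  next
    case adj: True
    show ?thesis
    proof (cases "C \<union> X = UNIV")
      case eq: True
      then have "C = Y" "D = X"
        using sup(1)[OF C(1)] sup(2)[OF D(1)] True by (simp_all add: Un_commute)
      then show ?thesis
        by blast
    next
      case False
      then have "D = Y" "C = X"
        using adj sup(1)[OF D(1)] sup(2)[OF C(1)] True by simp_all
      then show ?thesis
        by blast
    qed
  qed
  have "?thesis \<or> {C, D} = {A, B}"
    using light
  proof
    assume "weight A a < t"
    then show ?thesis
      using via[of A B] A(1) A_sup B_sup by blast
  next
    assume "weight B a < t"
    then show ?thesis
      using via[of B A] B(1) A_sup B_sup unfolding insert_commute[of B] by blast
  qed
  then show ?thesis
  proof
    assume CD: "{C, D} = {A, B}"
    then have "weight A a < t" "weight B a < t"
      using C D by (auto simp: doubleton_eq_iff)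
    then obtain E where E: "E \<in> Covers" "E \<noteq> A" "E \<noteq> B" "weight E a < t"
      using no_solution_light_cover by blast
    then have "E \<union> A \<noteq> UNIV" "E \<union> B \<noteq> UNIV"
      using A_sup B_sup by blast+
    then show ?thesis
      using E CD by (auto simp: doubleton_eq_iff Un_commute)
  qed
qed

text \<open>A minimal cover omitting a single vertex would make the graph a star, with no minimal
  covers besides \<open>A\<close> and \<open>B\<close>; then the zero vector lifts to a solution of
  size \<open>t - 1\<close>.\<close>

lemma two_vertices_off_cover:
  assumes C: "C \<in> Covers"
  obtains i j where "i \<noteq> j" "i \<notin> C" "j \<notin> C"
proof -
  obtain i where i: "i \<notin> C"
    using min_vertex_cover_not_UNIV[OF C] by blast
  have "\<not> - {i} \<subseteq> C"
  proof
    assume sub: "- {i} \<subseteq> C"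
    have "D = A \<or> D = B" if "D \<in> Covers" for D
    proof (cases "i \<in> A")
      case False
      then have "i \<in> B"
        using parts by blast
      then show ?thesis
        using connected_bipartite_graph.star_covers[OF swap C sub _ that] by blast
    qed (rule star_covers[OF C sub _ that])
    then show False
      using solution_lift[of 0 "t - 1"] no_solution by (auto simp: weight_def)
  qed
  then show ?thesis
    using that i by blast
qed

lemma division_modulo_cover_bound:
  fixes u v :: "('v, 'k::field) mpoly"
  assumes e: "inj e" and uv: "power_form e * u - linear_form * v \<in> supported (cover_bound t)"
  shows "\<exists>w. u - linear_form * w \<in> supported (cover_bound t)"
  unfolding cover_bound_def
proof (rule glue_division[where N = "\<lambda>C D. C \<union> D \<noteq> UNIV"])
  show "\<exists>j. \<forall>a. (t \<le> weight C (a + single j 1) \<longrightarrow> t \<le> weight C a) \<and>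
      (t \<le> weight D (a + single j 1) \<longrightarrow> t \<le> weight D a)" if CD: "C \<union> D \<noteq> UNIV" for C D :: "'v set"
  proof -
    obtain j where "j \<notin> C" "j \<notin> D"
      using CD by auto
    then show ?thesis
      by (intro exI[of _ j]) (simp add: weight_add_single_outside)
  qed
  show "\<exists>E\<in>Covers. \<not> t \<le> weight E a \<and> C \<union> E \<noteq> UNIV \<and> E \<union> D \<noteq> UNIV"
    if "C \<in> Covers" "D \<in> Covers" "\<not> t \<le> weight C a" "\<not> t \<le> weight D a" for a C D
    using light_covers_connected[of C a D] that by (simp add: not_le)
  show "\<exists>w. u - linear_form * w \<in> supported (\<lambda>a. t \<le> weight C a)" if C: "C \<in> Covers" for C
  proof -
    have uv': "power_form e * u - linear_form * v \<in> supported (\<lambda>a. t \<le> weight C a)"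
      using C by (intro supported_mono[OF uv]) (simp add: cover_bound_def)
    \<comment> \<open>Injectivity of \<open>e\<close> lets the omitted vertices be ordered by
      exponent, as \<open>power_form_regular\<close> requires.\<close>
    obtain i j where ij: "i \<notin> C" "j \<notin> C" "e i < e j"
      using two_vertices_off_cover[OF C] e by (metis injD linorder_neqE_nat)
    show ?thesis
      using ij by (intro power_form_regular[OF upclosed_weight _ _ ij(3) uv'])
        (simp_all add: weight_add_single_outside)
  qed
qed (simp_all add: upclosed_weight)

end

section \<open>Bounds on the depth\<close>

lemma supported_cover_bound_proper: "t \<ge> 1 \<Longrightarrow> supported (cover_bound t) \<subseteq> supported (\<lambda>a. a \<noteq> 0)"
  using min_vertex_cover_part by (auto simp: supported_def cover_bound_def weight_def)

lemma depth_ge_1: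
  assumes t: "t \<ge> 1"
  shows "1 \<le> depth_quotient (ideal_power (edge_ideal G :: ('v, 'k::field) mpoly set) t)"
proof -
  let ?f = "linear_form :: ('v, 'k) mpoly"
  have "ideal_gen (supported (cover_bound t) \<union> {?f}) \<noteq> UNIV"
    using supported_cover_bound_proper[OF t] irrelevant_ideal_subset linear_form_in_irrelevant
    by (intro ideal_gen_proper) blast
  then have "regular_seq_on_quotient (supported (cover_bound t)) [?f]"
    using regular_seq_singleton_iff[OF subspace_supported[OF upclosed_cover_bound]]
      linear_form_nonzerodivisor by blast
  then show ?thesis
    using depth_quotient_ge[of "[?f]"] linear_form_in_irrelevant
    by (simp add: ideal_power_edge_ideal one_enat_def)
qed

lemma depth_ge_2:
  assumes t: "t \<ge> 1"
    and no_solution: "\<nexists>b. cover_system_solution G A B b \<and> (\<Sum>i\<in>A. b i) = t - 1"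
  shows "2 \<le> depth_quotient (ideal_power (edge_ideal G :: ('v, 'k::field) mpoly set) t)"
proof -
  obtain e' :: "'v \<Rightarrow> nat" and n where "inj e'"
    using finite_imp_inj_to_nat_seg[of "UNIV :: 'v set"] by auto
  \<comment> \<open>The shift makes all exponents positive, which keeps the form in the irrelevant
    ideal.\<close>
  define e where "e l = Suc (e' l)" for l
  have e: "inj e" "\<And>l. e l > 0"
    using \<open>inj e'\<close> by (auto simp: inj_def e_def)
  let ?f = "linear_form :: ('v, 'k) mpoly" and ?g = "power_form e :: ('v, 'k) mpoly"
  have irr: "?f \<in> irrelevant_ideal" "?g \<in> irrelevant_ideal"
    by (rule linear_form_in_irrelevant power_form_in_irrelevant e)+
  have "ideal_gen (supported (cover_bound t) \<union> {?f, ?g}) \<noteq> UNIV"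
    using supported_cover_bound_proper[OF t] irrelevant_ideal_subset irr
    by (intro ideal_gen_proper) blast
  then have "regular_seq_on_quotient (supported (cover_bound t)) [?f, ?g]"
    using regular_seq_pair_iff[OF subspace_supported[OF upclosed_cover_bound]]
      linear_form_nonzerodivisor division_modulo_cover_bound[OF t no_solution e(1)] by blast
  then show ?thesis
    using depth_quotient_ge[of "[?f, ?g]"] irr
    by (simp add: ideal_power_edge_ideal numeral_eq_enat eval_nat_numeral)
qed

text \<open>Adding one edge \<open>n\<close> times raises each part by exactly \<open>n\<close> and
  every cover by at least \<open>n\<close>.\<close>

lemma solution_add_edges:
  assumes a: "cover_system_solution G A B a"
  obtains b where "weight A b = (\<Sum>i\<in>A. a i) + n" "weight B b = (\<Sum>i\<in>A. a i) + n"
    "\<And>C. C \<in> Covers \<Longrightarrow> C \<noteq> A \<Longrightarrow> C \<noteq> B \<Longrightarrow> (\<Sum>i\<in>A. a i) + n < weight C b"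
proof -
  obtain u where u: "u \<in> A"
    using part_nonempty by blast
  obtain v where uv: "(u, v) \<in> parcs G"
    by (rule neighbor)
  then have v: "v \<in> B" "v \<notin> A" "u \<notin> B"
    using arc_parts[OF uv] u parts by blast+
  have lookup_a: "lookup (Abs_poly_mapping a) = a"
    by simp
  define b where "b = Abs_poly_mapping a + single u n + single v n"
  have w: "weight C b = (\<Sum>i\<in>C. a i) + (if u \<in> C then n else 0) + (if v \<in> C then n else 0)" for C
    unfolding b_def weight_add weight_single by (simp add: weight_def lookup_a)
  show ?thesis
  proof (rule that[of b])
    show "weight A b = (\<Sum>i\<in>A. a i) + n" "weight B b = (\<Sum>i\<in>A. a i) + n"
      using a u v by (simp_all add: w cover_system_solution_def)
    fix C assume C: "C \<in> Covers" "C \<noteq> A" "C \<noteq> B"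
    then have "u \<in> C \<or> v \<in> C"
      using min_vertex_coverD[OF C(1)] uv by (auto simp: vertex_cover_def)
    then show "(\<Sum>i\<in>A. a i) + n < weight C b"
      using a C by (auto simp: w cover_system_solution_def)
  qed
qed

lemma depth_le_1:
  assumes a: "cover_system_solution G A B a" and t: "(\<Sum>i\<in>A. a i) < t"
  shows "depth_quotient (ideal_power (edge_ideal G :: ('v, 'k::field) mpoly set) t) \<le> 1"
proof -
  let ?J = "supported (cover_bound t) :: ('v, 'k) mpoly set"
  \<comment> \<open>The solution is raised to size exactly \<open>t - 1\<close>: \<open>A\<close>
    and \<open>B\<close> miss the bound by one and all other covers reach it, so only a factor
    meeting both parts brings \<open>x^b\<close> into the ideal.\<close>
  have eq: "(\<Sum>i\<in>A. a i) + (t - 1 - (\<Sum>i\<in>A. a i)) = t - 1"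
    using t by simp
  obtain b where wb: "weight A b = t - 1" "weight B b = t - 1"
      "\<And>C. C \<in> Covers \<Longrightarrow> C \<noteq> A \<Longrightarrow> C \<noteq> B \<Longrightarrow> t - 1 < weight C b"
    using solution_add_edges[OF a, of "t - 1 - (\<Sum>i\<in>A. a i)"] unfolding eq by blast
  have b: "weight A b < t" "weight B b < t" "t \<le> Suc (weight A b)" "t \<le> Suc (weight B b)"
    using t wb(1,2) by auto
  have bC: "t \<le> weight C b" if "C \<in> Covers" "C \<noteq> A" "C \<noteq> B" for C
    using wb(3)[OF that] by simp
  have "length fs \<le> 1" if fs: "set fs \<subseteq> irrelevant_ideal" "regular_seq_on_quotient ?J fs" for fs
  proof (rule ccontr)
    assume "\<not> length fs \<le> 1"
    then have len: "length fs \<ge> 2"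
      by simp
    define f g where "f = fs ! 0" and "g = fs ! 1"
    have reg: "regular_seq_on_quotient ?J [f, g]"
      unfolding f_def g_def by (rule regular_seq_take2[OF fs(2) len])
    have "f \<in> set fs" "g \<in> set fs"
      unfolding f_def g_def by (rule nth_mem, use len in linarith)+
    then have f0: "lookup f 0 = 0" "lookup g 0 = 0"
      using fs(1) by (blast intro: irrelevant_lookup_zero)+
    show False
    proof (rule not_regular_pair[OF upclosed_cover_bound parts(1) part_nonempty
          swapped.part_nonempty _ _ _ f0])
      show "\<not> cover_bound t (single i 1 + b)" if "i \<in> A" for i
      proof -
        have "i \<notin> B"
          using that parts by blast
        then show ?thesis
          using b(2) swapped.min_vertex_cover_part
          by (auto simp: cover_bound_def weight_add weight_single not_le intro!: bexI[of _ B])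
      qed
      show "\<not> cover_bound t (single j 1 + b)" if "j \<in> B" for j
      proof -
        have "j \<notin> A"
          using that parts by blast
        then show ?thesis
          using b(1) min_vertex_cover_part
          by (auto simp: cover_bound_def weight_add weight_single not_le intro!: bexI[of _ A])
      qed
      show "cover_bound t (c + b)" if "i \<in> A" "lookup c i > 0" "j \<in> B" "lookup c j > 0" for c i j
        unfolding cover_bound_def weight_add
      proof
        fix C assume C: "C \<in> Covers"
        have "1 \<le> weight A c" "1 \<le> weight B c"
          using weight_ge_lookup[OF that(1), of c] weight_ge_lookup[OF that(3), of c] that by auto
        then show "t \<le> weight C c + weight C b"
          using b(3,4) bC[OF C] by (cases "C = A"; cases "C = B") auto
      qed
      show "r \<in> ?J" if "f * r \<in> ?J" for r
        using reg that regular_seq_pair_iff[OF subspace_supported[OF upclosed_cover_bound]] by blast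
      show "\<exists>w. u - f * w \<in> ?J" if "g * u - f * v \<in> ?J" for u v
        using reg that regular_seq_pair_iff[OF subspace_supported[OF upclosed_cover_bound]] by blast
    qed
  qed
  then show ?thesis
    unfolding ideal_power_edge_ideal one_enat_def by (rule depth_quotient_le)
qed

text \<open>The degree sequence is a solution: a vertex cover \<open>C\<close> meets every edge, and by connectedness
  it contains both ends of some edge unless \<open>C\<close> is one of the two parts.\<close>

lemma solution_exists: "\<exists>a. cover_system_solution G A B a"
proof -
  \<comment> \<open>Orienting edges from \<open>A\<close> to \<open>B\<close> counts each of them
    once.\<close>
  define E where "E = {(u, v) \<in> parcs G. u \<in> A}"
  define a :: "'v \<Rightarrow> nat" where
    "a w = (\<Sum>(u, v)\<in>E. (if u = w then 1 else 0) + (if v = w then 1 else 0))" for w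
  have E: "u \<in> A" "v \<in> B" "u \<notin> B" "v \<notin> A" "(u, v) \<in> parcs G" if "(u, v) \<in> E" for u v
    using that arc_parts[of u v] parts by (auto simp: E_def)
  have sum_a: "(\<Sum>w\<in>C. a w) = (\<Sum>(u, v)\<in>E. (if u \<in> C then 1 else 0) + (if v \<in> C then 1 else 0))" for C
    unfolding a_def by (subst sum.swap) (simp add: sum.distrib case_prod_unfold)
  have A: "(\<Sum>w\<in>A. a w) = (\<Sum>(u, v)\<in>E. 1)" and B: "(\<Sum>w\<in>B. a w) = (\<Sum>(u, v)\<in>E. 1)"
    unfolding sum_a by (intro sum.cong; auto dest: E)+
  have less: "(\<Sum>w\<in>A. a w) < (\<Sum>w\<in>C. a w)" if C: "C \<in> Covers" "C \<noteq> A" "C \<noteq> B" for C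
    unfolding A unfolding sum_a
  proof (rule sum_strict_mono_ex1)
    \<comment> \<open>An edge between \<open>S\<close> and its complement has both ends in
      \<open>C\<close> or both outside, and the latter is impossible for a cover. \<open>S\<close>
      is empty only for \<open>C = B\<close> and everything only for \<open>C = A\<close>.\<close>
    define S where "S = (C \<inter> A) \<union> (B - C)"
    have "S \<noteq> {}"
      using min_vertex_cover_superset_part[OF C(1)] swapped.min_vertex_cover_superset_part[OF C(1)] C parts
      unfolding S_def by blast
    moreover have "S \<noteq> UNIV"
      using min_vertex_cover_superset_part[OF C(1)] swapped.min_vertex_cover_superset_part[OF C(1)] C parts
      unfolding S_def by blast
    ultimately obtain u v where uv: "(u, v) \<in> parcs G" "u \<in> S" "v \<notin> S"
      using connected_cut[OF connected verts arc_sym] by blast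
    have "u \<in> C \<or> v \<in> C"
      using min_vertex_coverD[OF C(1)] uv(1) by (auto simp: vertex_cover_def)
    then have "u \<in> C" "v \<in> C"
      using uv arc_parts[OF uv(1)] parts unfolding S_def by blast+
    moreover have "(u, v) \<in> E \<or> (v, u) \<in> E"
      using uv(1) arc_parts[OF uv(1)] arc_sym by (auto simp: E_def)
    ultimately show "\<exists>e\<in>E. (case e of (u, v) \<Rightarrow> 1)
        < (case e of (u, v) \<Rightarrow> (if u \<in> C then 1 else 0) + (if v \<in> C then 1 else (0 :: nat)))"
      by (elim disjE) force+
    show "\<forall>e\<in>E. (case e of (u, v) \<Rightarrow> 1)
        \<le> (case e of (u, v) \<Rightarrow> (if u \<in> C then 1 else 0) + (if v \<in> C then 1 else (0 :: nat)))"
      using min_vertex_coverD[OF C(1)] by (auto simp: vertex_cover_def dest!: E(5))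
  qed simp
  have "(\<Sum>w\<in>A. a w) = (\<Sum>w\<in>B. a w)"
    unfolding A B ..
  then show ?thesis
    unfolding cover_system_solution_def using less by blast
qed

end

section \<open>Value of the stability index\<close>

theorem theorem1p6:
  fixes G :: "'v::finite pair_pre_digraph" and A B :: "'v set"
    and I :: "('v, 'k::field) mpoly set"
  assumes "pair_graph G" and "pverts G = UNIV" and "card (pverts G) \<ge> 2"
    and "connected (with_proj G)" and "bipartition G A B"
    and "I = edge_ideal G"
  shows "(\<exists>s. depth_stable_from I s) \<and>
    (\<exists>a. cover_system_solution G A B a) \<and>
    real (dstab I) =
      (LEAST q. \<exists>a. cover_system_solution G A B a \<and> q = real (\<Sum>i\<in>UNIV. a i) / 2) + 1"
proof -
  interpret connected_bipartite_graph G A B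
    using assms(1-5) by (rule connected_bipartite_graph.intro)
  \<comment> \<open>For a solution, half of the total is the common sum over the parts, so the
    minimum can be taken over natural numbers.\<close>
  let ?P = "\<lambda>m. \<exists>a. cover_system_solution G A B a \<and> (\<Sum>i\<in>A. a i) = m"
  define m where "m = (LEAST m. ?P m)"
  have "\<exists>m. ?P m"
    using solution_exists by blast
  then have "?P m"
    unfolding m_def by (rule LeastI_ex)
  then obtain a where a: "cover_system_solution G A B a" "(\<Sum>i\<in>A. a i) = m"
    by blast
  have least: "m \<le> (\<Sum>i\<in>A. b i)" if "cover_system_solution G A B b" for b
    unfolding m_def by (rule Least_le) (use that in blast)
  have depth1: "depth_quotient (ideal_power I t) = 1" if "t \<ge> Suc m" for t
    unfolding assms(6) using that a(2)
    by (intro order_antisym depth_le_1[OF a(1)] depth_ge_1) auto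
  have stable: "depth_stable_from I (Suc m)"
    by (simp add: depth_stable_from_def depth1 del: ideal_power.simps)
  have "dstab I = Suc m"
    unfolding dstab_def
  proof (rule Least_equality)
    fix s assume s: "depth_stable_from I s"
    show "Suc m \<le> s"
    proof (rule ccontr)
      assume "\<not> Suc m \<le> s"
      then have "s \<le> m" "1 \<le> s"
        using s by (auto simp: depth_stable_from_def)
      then have "1 \<le> m"
        by simp
      moreover have "\<nexists>b. cover_system_solution G A B b \<and> (\<Sum>i\<in>A. b i) = m - 1"
        using least \<open>1 \<le> m\<close> by fastforce
      \<comment> \<open>Stability from some \<open>s \<le> m\<close> would give equal depths at
        \<open>m\<close> and \<open>Suc m\<close>, but minimality of \<open>m\<close> excludes
        solutions of size \<open>m - 1\<close>, so the depth drops there.\<close>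
      ultimately have "2 \<le> depth_quotient (ideal_power I m)"
        unfolding assms(6) by (rule depth_ge_2)
      moreover have "depth_quotient (ideal_power I m) = depth_quotient (ideal_power I (Suc m))"
        using s \<open>s \<le> m\<close> unfolding depth_stable_from_def by (metis le_SucI)
      ultimately show False
        by (simp add: depth1 numeral_eq_enat one_enat_def del: ideal_power.simps)
    qed
  qed (rule stable)
  moreover have half: "real (\<Sum>i\<in>UNIV. b i) / 2 = real (\<Sum>i\<in>A. b i)"
    if "cover_system_solution G A B b" for b
    using that sum_over_parts[of b] by (simp add: cover_system_solution_def)
  have "(LEAST q. \<exists>a. cover_system_solution G A B a \<and> q = real (\<Sum>i\<in>UNIV. a i) / 2) = real m"
  proof (rule Least_equality)
    show "\<exists>a. cover_system_solution G A B a \<and> real m = real (\<Sum>i\<in>UNIV. a i) / 2"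
      using a half by metis
    show "real m \<le> q" if q: "\<exists>a. cover_system_solution G A B a \<and> q = real (\<Sum>i\<in>UNIV. a i) / 2" for q
    proof -
      obtain b where b: "cover_system_solution G A B b" "q = real (\<Sum>i\<in>UNIV. b i) / 2"
        using q by blast
      show ?thesis
        unfolding b(2) half[OF b(1)] using least[OF b(1)] by (rule of_nat_mono)
    qed
  qed
  ultimately show ?thesis
    using stable a(1) by auto
qed

end
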